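(* Let $D\subsetneq\mathbb{R}^n$ be an open set with $\partial D\neq\emptyset$. For any $x\in D$ and $r\in\left(0,\frac12\right)$, $$B_k(x,R_1)\subset B_{\tilde c}(x,r)\subset B_k(x,R_2),$$ where $R_1=\log(1+r)$ and $R_2=\log\left(1+\frac{r}{1-2r}\right)$. Moreover, $R_2/R_1\to 1$ as $r\to 0$.
   Context: $d(z)=d(z,\partial D)$ is the Euclidean distance from $z$ to the boundary $\partial D$ of $D$ in $\mathbb{R}^n$. For $x,y\in D$: $\tilde c_D(x,y)=\sup_{p\in\partial D}\frac{|x-y|}{\max\{|x-p|,|y-p|\}}$, and the quasihyperbolic metric is $k_D(x,y)=\inf_{\gamma\in\Gamma(x,y)}\int_\gamma\frac{|dz|}{d(z)}$, where $\Gamma(x,y)$ is the set of rectifiable arcs in $D$ connecting $x$ and $y$ (with the convention $\inf\emptyset=+\infty$ if $x,y$ lie in different components of $D$). Metric balls: $B_{\tilde c}(x,r)=\{y\in D:\tilde c_D(x,y)<r\}$ and $B_k(x,R)=\{y\in D:k_D(x,y)<R\}$. *)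

theory Defs
  imports "HOL-Analysis.Analysis"
begin

definition bd_dist :: "'a::euclidean_space set \<Rightarrow> 'a \<Rightarrow> real" where
  "bd_dist D z = infdist z (frontier D)"

text \<open>For \<open>x, y \<in> D\<close> with \<open>D\<close> open and \<open>frontier D \<noteq> {}\<close> the supremum is taken over a nonempty
  set bounded by 2, and no denominator vanishes.\<close>

definition c_tilde :: "'a::euclidean_space set \<Rightarrow> 'a \<Rightarrow> 'a \<Rightarrow> real" where
  "c_tilde D x y = (SUP p\<in>frontier D. norm (x - y) / max (norm (x - p)) (norm (y - p)))"

definition curve_length :: "(real \<Rightarrow> 'a::euclidean_space) \<Rightarrow> real \<Rightarrow> real \<Rightarrow> ennreal" where
  "curve_length g a b =
     (SUP (n, t) \<in> {(n, t :: nat \<Rightarrow> real). t 0 = a \<and> t n = b \<and> mono_on {..n} t}.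
        \<Sum>i<n. ennreal (norm (g (t (Suc i)) - g (t i))))"

definition rectifiable :: "(real \<Rightarrow> 'a::euclidean_space) \<Rightarrow> bool" where
  "rectifiable g \<longleftrightarrow> curve_length g 0 1 < \<infinity>"

definition arclen :: "(real \<Rightarrow> 'a::euclidean_space) \<Rightarrow> real \<Rightarrow> real" where
  "arclen g t = enn2real (curve_length g 0 t)"

text \<open>For a rectifiable arc, \<open>arclen g\<close> is a strictly increasing continuous bijection from \<open>{0..1}\<close>
  onto \<open>{0..arclen g 1}\<close>, so its inverse below is the genuine one and gives the parametrization
  by arc length.\<close>

definition arclen_param :: "(real \<Rightarrow> 'a::euclidean_space) \<Rightarrow> real \<Rightarrow> 'a" where
  "arclen_param g s = g (inv_into {0..1} (arclen g) s)"

definition line_integral :: "(real \<Rightarrow> 'a::euclidean_space) \<Rightarrow> ('a \<Rightarrow> real) \<Rightarrow> ennreal" where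
  "line_integral g f = (\<integral>\<^sup>+ s \<in> {0..arclen g 1}. ennreal (f (arclen_param g s)) \<partial>lborel)"

text \<open>The constant curve is admitted as a degenerate arc from \<open>x\<close> to itself, so that the
  quasihyperbolic distance from a point to itself is 0; \<open>arc\<close> alone requires injectivity, hence
  distinct endpoints.\<close>

definition rect_arcs :: "'a::euclidean_space set \<Rightarrow> 'a \<Rightarrow> 'a \<Rightarrow> (real \<Rightarrow> 'a) set" where
  "rect_arcs D x y =
     {g. (arc g \<or> (\<forall>t\<in>{0..1}. g t = x)) \<and> rectifiable g \<and> path_image g \<subseteq> D \<and>
         pathstart g = x \<and> pathfinish g = y}"

text \<open>In \<open>ennreal\<close> the infimum of the empty set is \<open>\<infinity>\<close>, as wanted for points in different
  components.\<close>

definition qh_dist :: "'a::euclidean_space set \<Rightarrow> 'a \<Rightarrow> 'a \<Rightarrow> ennreal" where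
  "qh_dist D x y = (INF g\<in>rect_arcs D x y. line_integral g (\<lambda>z. 1 / bd_dist D z))"

definition c_tilde_ball :: "'a::euclidean_space set \<Rightarrow> 'a \<Rightarrow> real \<Rightarrow> 'a set" where
  "c_tilde_ball D x r = {y \<in> D. c_tilde D x y < r}"

definition qh_ball :: "'a::euclidean_space set \<Rightarrow> 'a \<Rightarrow> real \<Rightarrow> 'a set" where
  "qh_ball D x R = {y \<in> D. qh_dist D x y < ennreal R}"

end

theory Submission
  imports Defs "HOL-Real_Asymp.Real_Asymp"
begin

text \<open>
  Along an arc from \<open>x\<close> parametrized by arc length, the distance to the boundary at parameter \<open>s\<close>
  is at most \<open>bd_dist D x + s\<close>; integrating, \<open>ln (1 + \<bar>x - y\<bar> / bd_dist D x)\<close> is a lower bound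
  for the quasihyperbolic distance. Along the segment from \<open>x\<close> to \<open>y\<close> it is at least
  \<open>bd_dist D x - s\<close>, which gives the upper bound \<open>- ln (1 - \<bar>x - y\<bar> / bd_dist D x)\<close>.
  On the other side, \<open>c_tilde D x y\<close> lies between \<open>\<bar>x - y\<bar> / (bd_dist D x + \<bar>x - y\<bar>)\<close> (take for \<open>p\<close>
  a boundary point nearest to \<open>x\<close>) and \<open>\<bar>x - y\<bar> / bd_dist D x\<close>.
\<close>

section \<open>Length of curves as a supremum over partitions\<close>

lemma curve_length_upper:
  assumes "t 0 = a" "t n = b" "mono_on {..n} t"
  shows "(\<Sum>i<n. ennreal (norm (g (t (Suc i)) - g (t i)))) \<le> curve_length g a b"
proof -
  have "(n, t) \<in> {(n, t :: nat \<Rightarrow> real). t 0 = a \<and> t n = b \<and> mono_on {..n} t}"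
    using assms by simp
  from SUP_upper[OF this, of "\<lambda>(n, t). \<Sum>i<n. ennreal (norm (g (t (Suc i)) - g (t i)))"]
  show ?thesis unfolding curve_length_def by simp
qed

lemma curve_length_least:
  assumes "\<And>n t. t 0 = a \<Longrightarrow> t n = b \<Longrightarrow> mono_on {..n} t \<Longrightarrow>
    (\<Sum>i<n. ennreal (norm (g (t (Suc i)) - g (t i)))) \<le> c"
  shows "curve_length g a b \<le> c"
  unfolding curve_length_def by (rule SUP_least) (use assms in auto)

lemma norm_diff_le_curve_length:
  assumes "a \<le> b"
  shows "ennreal (norm (g b - g a)) \<le> curve_length g a b"
proof -
  have "mono_on {..1} (\<lambda>i::nat. if i = 0 then a else b)"
    using assms by (auto simp: mono_on_def)
  from curve_length_upper[OF _ _ this, of a b g] show ?thesis by simp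
qed

text \<open>Joining a partition of the first interval to one of the second gives a partition of the
  whole, and the sums add; then both suprema are taken. This bounds the lengths of initial and final
  pieces of a curve by its total length.\<close>

lemma curve_length_superadditive:
  assumes "a \<le> b" "b \<le> c"
  shows "curve_length g a b + curve_length g b c \<le> curve_length g a c"
proof -
  have *: "(\<Sum>i<n. ennreal (norm (g (t (Suc i)) - g (t i)))) +
        (\<Sum>i<m. ennreal (norm (g (u (Suc i)) - g (u i)))) \<le> curve_length g a c"
    if t: "t 0 = a" "t n = b" "mono_on {..n} t" and u: "u 0 = b" "u m = c" "mono_on {..m} u"
    for n m t u
  proof -
    \<comment> \<open>The join is at index \<open>n\<close>, where \<open>t n\<close> and
      \<open>u 0\<close> are both \<open>b\<close>; hence \<open>w (n + i) = u i\<close> also for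
      \<open>i = 0\<close>.\<close>
    define w where "w = (\<lambda>i. if i \<le> n then t i else u (i - n))"
    have w_shift: "w (n + i) = u i" for i
      using t u by (cases i) (auto simp: w_def)
    have "mono_on {..n + m} w"
    proof (rule mono_onI)
      fix i j assume ij: "i \<in> {..n + m}" "j \<in> {..n + m}" "i \<le> j"
      consider "j \<le> n" | "i \<le> n" "n < j" | "n < i" by linarith
      then show "w i \<le> w j"
      proof cases
        case 1
        then show ?thesis using ij t(3) by (auto simp: w_def mono_on_def)
      next
        case 2
        have "t i \<le> t n" using 2 t(3) by (auto simp: mono_on_def)
        moreover have "u 0 \<le> u (j - n)" using 2 ij u(3) by (auto simp: mono_on_def)
        ultimately show ?thesis using 2 t u by (auto simp: w_def)
      next
        case 3
        then have "u (i - n) \<le> u (j - n)" using ij by (intro mono_onD[OF u(3)]) auto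
        then show ?thesis using 3 ij by (simp add: w_def)
      qed
    qed
    moreover have "w 0 = a" "w (n + m) = c"
      using t u w_shift by (auto simp: w_def)
    ultimately have "(\<Sum>i<n + m. ennreal (norm (g (w (Suc i)) - g (w i)))) \<le> curve_length g a c"
      by (intro curve_length_upper)
    moreover have "(\<Sum>i<n + m. ennreal (norm (g (w (Suc i)) - g (w i)))) =
        (\<Sum>i<n. ennreal (norm (g (w (Suc i)) - g (w i)))) +
        (\<Sum>i<m. ennreal (norm (g (w (n + Suc i)) - g (w (n + i)))))"
      by (induction m) (simp_all add: add.assoc)
    moreover have "(\<Sum>i<n. ennreal (norm (g (w (Suc i)) - g (w i)))) =
        (\<Sum>i<n. ennreal (norm (g (t (Suc i)) - g (t i))))"
      by (intro sum.cong) (auto simp: w_def)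
    ultimately show ?thesis
      by (simp only: w_shift)
  qed
  define P where "P = (\<lambda>a b. {(n, t :: nat \<Rightarrow> real). t 0 = a \<and> t n = b \<and> mono_on {..n} t})"
  define V where "V = (\<lambda>(n, t :: nat \<Rightarrow> real). \<Sum>i<n. ennreal (norm (g (t (Suc i)) - g (t i))))"
  have len: "curve_length g a b = (SUP p\<in>P a b. V p)" for a b
    by (simp add: curve_length_def P_def V_def)
  \<comment> \<open>In \<open>ennreal\<close> the empty supremum is 0, so a constant summand may be
    moved into a supremum only over a nonempty index set.\<close>
  have nonempty: "P a b \<noteq> {}" if "a \<le> b" for a b
  proof -
    have "(1, \<lambda>i. if i = 0 then a else b) \<in> P a b"
      using that by (auto simp: P_def mono_on_def)
    then show ?thesis by blast
  qed
  have "curve_length g a b + curve_length g b c = (SUP p\<in>P a b. V p + curve_length g b c)"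
    unfolding len by (rule ennreal_SUP_add_left[OF nonempty[OF assms(1)], symmetric])
  also have "\<dots> = (SUP p\<in>P a b. SUP q\<in>P b c. V p + V q)"
    unfolding len by (simp only: ennreal_SUP_add_right[OF nonempty[OF assms(2)]])
  also have "\<dots> \<le> curve_length g a c"
  proof (intro SUP_least)
    fix p q assume "p \<in> P a b" "q \<in> P b c"
    then show "V p + V q \<le> curve_length g a c"
      using *[of "snd p" "fst p" "snd q" "fst q"]
      by (simp add: P_def V_def case_prod_beta del: sum_ennreal)
  qed
  finally show ?thesis .
qed

section \<open>The arc length function and its inverse\<close>

text \<open>Arc length is a uniform limit of continuous functions. With continuity, the intermediate
  value theorem shows that every value in \<open>{0..arclen g 1}\<close> is attained, so that
  \<open>arclen_param\<close> can be evaluated.\<close>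

lemma continuous_on_arclen:
  fixes g :: "real \<Rightarrow> 'a::euclidean_space"
  assumes g: "continuous_on {0..1} g" and rect: "rectifiable g"
  shows "continuous_on {0..1} (arclen g)"
proof -
  define L where "L = arclen g 1"
  define tail where "tail t = enn2real (curve_length g t 1)" for t
  have fin: "curve_length g 0 1 < \<infinity>"
    using rect by (simp add: rectifiable_def)
  have split: "curve_length g 0 t + curve_length g t 1 \<le> curve_length g 0 1" if "t \<in> {0..1}" for t
    using that by (intro curve_length_superadditive) auto
  have fin_t: "curve_length g 0 t < \<infinity>" "curve_length g t 1 < \<infinity>" if "t \<in> {0..1}" for t
  proof -
    have "curve_length g 0 t + curve_length g t 1 < \<infinity>"
      using split[OF that] fin by (rule le_less_trans)
    then show "curve_length g 0 t < \<infinity>" "curve_length g t 1 < \<infinity>"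
      by auto
  qed
  have len_t: "curve_length g 0 t = ennreal (arclen g t)" "curve_length g t 1 = ennreal (tail t)"
    if "t \<in> {0..1}" for t
    using fin_t[OF that] by (simp_all add: arclen_def tail_def)
  have nonneg: "0 \<le> arclen g t" "0 \<le> tail t" for t
    by (simp_all add: arclen_def tail_def)
  have split': "arclen g t + tail t \<le> L" if "t \<in> {0..1}" for t
    using split[OF that] len_t[OF that] len_t(1)[of 1] nonneg
    by (simp add: L_def flip: ennreal_plus)
  \<comment> \<open>The inscribed polygons of an almost optimal partition, cut at \<open>t\<close>, approximate the arc length
    from below on both sides of \<open>t\<close>, hence uniformly in \<open>t\<close>.\<close>
  have approx: "\<exists>A. continuous_on {0..1} A \<and> (\<forall>t\<in>{0..1}. \<bar>arclen g t - A t\<bar> \<le> e)" if "0 < e" for e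
  proof -
    have "\<exists>n u. u 0 = 0 \<and> u n = 1 \<and> mono_on {..n} u \<and>
        L - e \<le> (\<Sum>i<n. norm (g (u (Suc i)) - g (u i)))"
    proof (rule ccontr)
      assume contr: "\<not> ?thesis"
      have "curve_length g 0 1 \<le> ennreal (L - e)"
      proof (rule curve_length_least)
        fix n and u :: "nat \<Rightarrow> real"
        assume "u 0 = 0" "u n = 1" "mono_on {..n} u"
        then have "(\<Sum>i<n. norm (g (u (Suc i)) - g (u i))) \<le> L - e"
          using contr by (meson linear)
        then show "(\<Sum>i<n. ennreal (norm (g (u (Suc i)) - g (u i)))) \<le> ennreal (L - e)"
          by (simp add: sum_ennreal ennreal_leI)
      qed
      then have "ennreal L \<le> ennreal (L - e)"
        using len_t(1)[of 1] by (simp add: L_def)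
      \<comment> \<open>Since \<open>ennreal\<close> truncates negative numbers to 0, the inequality
        leaves the case \<open>L \<le> 0\<close> open. There any partition gives the contradiction:
        its sum is nonnegative, while \<open>L - e\<close> is negative.\<close>
      then have L0: "L \<le> 0" using \<open>0 < e\<close> by (auto simp: ennreal_le_iff2)
      have "\<exists>(n::nat) u. u 0 = (0::real) \<and> u n = 1 \<and> mono_on {..n} u"
        by (intro exI[of _ "1::nat"] exI[of _ "\<lambda>i::nat. if i = 0 then 0 else 1"])
          (auto simp: mono_on_def)
      then obtain n and u :: "nat \<Rightarrow> real" where u: "u 0 = 0" "u n = 1" "mono_on {..n} u"
        by blast
      have "0 \<le> (\<Sum>i<n. norm (g (u (Suc i)) - g (u i)))"
        by (simp add: sum_nonneg)
      then show False using contr u L0 \<open>0 < e\<close> by force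
    qed
    then obtain n and u :: "nat \<Rightarrow> real"
      where u: "u 0 = 0" "u n = 1" "mono_on {..n} u"
        and near: "L - e \<le> (\<Sum>i<n. norm (g (u (Suc i)) - g (u i)))"
      by blast
    have u01: "u i \<in> {0..1}" if "i \<le> n" for i
      using mono_onD[OF u(3), of 0 i] mono_onD[OF u(3), of i n] that u by auto
    define A where "A t = (\<Sum>i<n. norm (g (min (u (Suc i)) t) - g (min (u i) t)))" for t
    define B where "B t = (\<Sum>i<n. norm (g (max (u (Suc i)) t) - g (max (u i) t)))" for t
    have cont: "continuous_on {0..1} A"
      unfolding A_def using u01
      by (intro continuous_intros continuous_on_compose2[OF g]) (auto simp: min_le_iff_disj)
    have A_le: "A t \<le> arclen g t" and B_le: "B t \<le> tail t" if t: "t \<in> {0..1}" for t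
    proof -
      have "(\<Sum>i<n. ennreal (norm (g (min (u (Suc i)) t) - g (min (u i) t)))) \<le> curve_length g 0 t"
      proof (rule curve_length_upper)
        show "mono_on {..n} (\<lambda>i. min (u i) t)"
          using u(3) unfolding mono_on_def by (meson min.mono order_refl)
      qed (use t u in auto)
      then have "ennreal (A t) \<le> curve_length g 0 t"
        by (simp add: A_def sum_ennreal)
      then show "A t \<le> arclen g t"
        using len_t[OF t] nonneg by simp
      have "(\<Sum>i<n. ennreal (norm (g (max (u (Suc i)) t) - g (max (u i) t)))) \<le> curve_length g t 1"
      proof (rule curve_length_upper)
        show "mono_on {..n} (\<lambda>i. max (u i) t)"
          using u(3) unfolding mono_on_def by (meson max.mono order_refl)
      qed (use t u in auto)
      then have "ennreal (B t) \<le> curve_length g t 1"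
        by (simp add: B_def sum_ennreal)
      then show "B t \<le> tail t"
        using len_t[OF t] nonneg by simp
    qed
    \<comment> \<open>If \<open>t\<close> lies between \<open>u i\<close> and
      \<open>u (Suc i)\<close>, this is the triangle inequality through \<open>g t\<close>;
      otherwise one of the two clipped terms vanishes and the other is the original one.\<close>
    have sum_le: "(\<Sum>i<n. norm (g (u (Suc i)) - g (u i))) \<le> A t + B t" for t
      unfolding A_def B_def sum.distrib[symmetric]
    proof (rule sum_mono)
      fix i assume "i \<in> {..<n}"
      then have le: "u i \<le> u (Suc i)" using u(3) by (auto simp: mono_on_def)
      have "norm (g (u (Suc i)) - g (u i)) \<le> norm (g t - g (u i)) + norm (g (u (Suc i)) - g t)"
        by norm
      then show "norm (g (u (Suc i)) - g (u i)) \<le> norm (g (min (u (Suc i)) t) - g (min (u i) t)) +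
          norm (g (max (u (Suc i)) t) - g (max (u i) t))"
        using le by (auto simp: min_def max_def)
    qed
    \<comment> \<open>The chain is \<open>L - e \<le> A t + B t \<le> A t + tail t \<le> A t + L -
      arclen g t\<close>.\<close>
    have "\<bar>arclen g t - A t\<bar> \<le> e" if t: "t \<in> {0..1}" for t
      using A_le[OF t] B_le[OF t] sum_le[of t] near split'[OF t] by linarith
    with cont show ?thesis by blast
  qed
  show ?thesis
    unfolding continuous_on_iff
  proof (intro ballI allI impI)
    fix t e :: real assume t: "t \<in> {0..1}" and e: "0 < e"
    obtain A where A: "continuous_on {0..1} A" "\<And>t. t \<in> {0..1} \<Longrightarrow> \<bar>arclen g t - A t\<bar> \<le> e / 3"
      using approx[of "e / 3"] e by auto
    from A(1) t e obtain d where d: "0 < d"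
      "\<And>s. s \<in> {0..1} \<Longrightarrow> dist s t < d \<Longrightarrow> dist (A s) (A t) < e / 3"
      unfolding continuous_on_iff by (metis divide_pos_pos zero_less_numeral)
    have "dist (arclen g s) (arclen g t) < e" if "s \<in> {0..1}" "dist s t < d" for s
      using d(2)[OF that] A(2)[OF that(1)] A(2)[OF t] unfolding dist_real_def by linarith
    with d(1) show "\<exists>d>0. \<forall>s\<in>{0..1}. dist s t < d \<longrightarrow> dist (arclen g s) (arclen g t) < e"
      by blast
  qed
qed

lemma arclen_0: "arclen g 0 = 0"
proof -
  have "curve_length g 0 0 \<le> 0"
  proof (rule curve_length_least)
    fix n and t :: "nat \<Rightarrow> real" assume t: "t 0 = 0" "t n = 0" "mono_on {..n} t"
    have "t i = 0" if "i \<le> n" for i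
      using mono_onD[OF t(3), of 0 i] mono_onD[OF t(3), of i n] that t by auto
    then show "(\<Sum>i<n. ennreal (norm (g (t (Suc i)) - g (t i)))) \<le> 0"
      by simp
  qed
  then show ?thesis by (simp add: arclen_def)
qed

lemma norm_diff_le_arclen:
  assumes "rectifiable g" "t \<in> {0..1}"
  shows "norm (g t - g 0) \<le> arclen g t"
proof -
  \<comment> \<open>Finiteness comes first because \<open>enn2real\<close> sends infinity to
    0.\<close>
  have "curve_length g 0 t \<le> curve_length g 0 t + curve_length g t 1"
    by simp
  also have "\<dots> \<le> curve_length g 0 1"
    using assms by (intro curve_length_superadditive) auto
  also have "\<dots> < \<infinity>" using assms by (simp add: rectifiable_def)
  finally have "curve_length g 0 t = ennreal (arclen g t)"
    by (simp add: arclen_def)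
  with norm_diff_le_curve_length[of 0 t g] assms(2)
  have "ennreal (norm (g t - g 0)) \<le> ennreal (arclen g t)"
    by simp
  moreover have "0 \<le> arclen g t" by (simp add: arclen_def)
  ultimately show ?thesis by simp
qed

text \<open>The value \<open>s\<close> is attained by continuity, so \<open>inv_into\<close> returns
  a genuine preimage \<open>t\<close>. Integrands along the curve are estimated through this
  \<open>t\<close>.\<close>

lemma arclen_param_witness:
  assumes "continuous_on {0..1} g" "rectifiable g" "s \<in> {0..arclen g 1}"
  obtains t where "t \<in> {0..1}" "arclen g t = s" "arclen_param g s = g t"
proof -
  have "\<exists>t. 0 \<le> t \<and> t \<le> 1 \<and> arclen g t = s"
    using assms by (intro IVT') (auto simp: arclen_0 continuous_on_arclen)
  then have "s \<in> arclen g ` {0..1}" by force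
  then show ?thesis
    by (intro that[of "inv_into {0..1} (arclen g) s"])
      (simp_all only: inv_into_into f_inv_into_f arclen_param_def)
qed

text \<open>Increments of an affine path are multiples of \<open>y - x\<close>, so every partition
  sum telescopes to the same value; the chord gives the reverse inequality.\<close>

lemma curve_length_linepath:
  assumes "a \<le> b"
  shows "curve_length (linepath x y) a b = ennreal ((b - a) * norm (y - x))"
proof (rule antisym)
  have diff: "linepath x y t - linepath x y s = (t - s) *\<^sub>R (y - x)" for s t
    by (simp add: linepath_def algebra_simps)
  show "curve_length (linepath x y) a b \<le> ennreal ((b - a) * norm (y - x))"
  proof (rule curve_length_least)
    fix n and t :: "nat \<Rightarrow> real" assume t: "t 0 = a" "t n = b" "mono_on {..n} t"
    have "(\<Sum>i<n. norm (linepath x y (t (Suc i)) - linepath x y (t i))) =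
        (\<Sum>i<n. (t (Suc i) - t i) * norm (y - x))"
      using t(3) by (intro sum.cong) (auto simp: diff mono_on_def)
    also have "\<dots> = (b - a) * norm (y - x)"
      using t by (simp add: sum_lessThan_telescope flip: sum_distrib_right)
    finally show "(\<Sum>i<n. ennreal (norm (linepath x y (t (Suc i)) - linepath x y (t i))))
        \<le> ennreal ((b - a) * norm (y - x))"
      by (simp add: sum_ennreal)
  qed
  show "ennreal ((b - a) * norm (y - x)) \<le> curve_length (linepath x y) a b"
    using norm_diff_le_curve_length[OF assms, of "linepath x y"] assms by (simp add: diff)
qed

section \<open>Boundary distance and bounds for the quasihyperbolic distance\<close>

lemma bd_dist_pos:
  assumes "open D" "frontier D \<noteq> {}" "z \<in> D"
  shows "0 < bd_dist D z"
  unfolding bd_dist_def using assms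
  by (intro infdist_pos_not_in_closed) (auto simp: frontier_def interior_open)

lemma bd_dist_le: "bd_dist D z \<le> bd_dist D x + norm (z - x)"
  unfolding bd_dist_def dist_norm[symmetric] by (rule infdist_triangle)

text \<open>That a chord is no longer than its arc enters twice: the point at arc length
  \<open>s\<close> is within \<open>s\<close> of \<open>x\<close>, and the total length is at least
  \<open>norm (x - y)\<close>.\<close>

lemma line_integral_lower:
  assumes D: "open D" "frontier D \<noteq> {}" and x: "x \<in> D" and g: "g \<in> rect_arcs D x y"
  shows "ennreal (ln (1 + norm (x - y) / bd_dist D x)) \<le> line_integral g (\<lambda>z. 1 / bd_dist D z)"
proof -
  define d where "d = bd_dist D x"
  have d: "0 < d" using bd_dist_pos[OF D x] by (simp add: d_def)
  define L where "L = arclen g 1"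
  have rect: "rectifiable g" and ends: "g 0 = x" "g 1 = y" and img: "path_image g \<subseteq> D"
    using g by (auto simp: rect_arcs_def pathstart_def pathfinish_def)
  have cont: "continuous_on {0..1} g"
  proof -
    \<comment> \<open>The degenerate constant curve is not an \<open>arc\<close>, so its continuity
      is checked separately.\<close>
    have "arc g \<or> (\<forall>t\<in>{0..1}. g t = x)" using g by (simp add: rect_arcs_def)
    then show ?thesis
    proof
      assume "\<forall>t\<in>{0..1}. g t = x"
      then show ?thesis
        using continuous_on_cong[of "{0..1}" "{0..1}" g "\<lambda>_. x"] by simp
    qed (simp add: arc_def path_def)
  qed
  have L: "norm (x - y) \<le> L"
    using norm_diff_le_arclen[OF rect, of 1] ends by (simp add: L_def norm_minus_commute)
  then have L0: "0 \<le> L" using norm_ge_zero order_trans by blast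
  \<comment> \<open>The form \<open>d + 0\<close> matches the antiderivative
    \<open>ln (d + s)\<close> evaluated at the lower limit 0.\<close>
  have "ennreal (ln (1 + norm (x - y) / d)) \<le> ennreal (ln (d + L) - ln (d + 0))"
  proof (rule ennreal_leI)
    have "ln (1 + norm (x - y) / d) \<le> ln ((d + L) / d)"
      using d L L0 by (subst ln_le_cancel_iff) (auto simp: field_simps add_pos_nonneg)
    then show "ln (1 + norm (x - y) / d) \<le> ln (d + L) - ln (d + 0)"
      using d L0 by (simp add: ln_div)
  qed
  also have "\<dots> = (\<integral>\<^sup>+ s \<in> {0..L}. ennreal (1 / (d + s)) \<partial>lborel)"
    using d L0 by (intro nn_integral_FTC_Icc[symmetric]) (auto intro!: derivative_eq_intros)
  also have "\<dots> \<le> line_integral g (\<lambda>z. 1 / bd_dist D z)"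
    unfolding line_integral_def L_def[symmetric]
  proof (rule nn_integral_mono)
    fix s
    show "ennreal (1 / (d + s)) * indicator {0..L} s
        \<le> ennreal (1 / bd_dist D (arclen_param g s)) * indicator {0..L} s"
    proof (cases "s \<in> {0..L}")
      case True
      then obtain t where t: "t \<in> {0..1}" "arclen g t = s" "arclen_param g s = g t"
        using arclen_param_witness[OF cont rect, of s] by (auto simp: L_def)
      have "g t \<in> D" using t(1) img by (auto simp: path_image_def)
      then have "0 < bd_dist D (g t)" by (rule bd_dist_pos[OF D])
      moreover have "bd_dist D (g t) \<le> d + s"
        using bd_dist_le[of D "g t" x] norm_diff_le_arclen[OF rect t(1)] t(2) ends
        by (simp add: d_def)
      ultimately show ?thesis
        using True t(3) by (simp add: ennreal_leI frac_le)
    qed simp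
  qed
  finally show ?thesis by (simp add: d_def)
qed

lemma qh_dist_lower:
  assumes "open D" "frontier D \<noteq> {}" "x \<in> D"
  shows "ennreal (ln (1 + norm (x - y) / bd_dist D x)) \<le> qh_dist D x y"
  unfolding qh_dist_def by (intro INF_greatest line_integral_lower assms)

text \<open>A ball is connected; if it met both \<open>D\<close> and the complement, it would
  contain a frontier point closer to \<open>x\<close> than the distance to the frontier.\<close>

lemma ball_bd_dist_subset:
  assumes "x \<in> D"
  shows "ball x (bd_dist D x) \<subseteq> D"
proof (rule ccontr)
  assume "\<not> ball x (bd_dist D x) \<subseteq> D"
  then have outside: "ball x (bd_dist D x) - D \<noteq> {}" by blast
  \<comment> \<open>A ball of nonpositive radius is empty, so the existence of a point outside
    \<open>D\<close> forces a positive radius.\<close>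
  then have "x \<in> ball x (bd_dist D x)"
    by (metis Diff_eq_empty_iff ball_eq_empty centre_in_ball empty_subsetI not_le)
  then have "ball x (bd_dist D x) \<inter> D \<noteq> {}"
    using assms by blast
  then have "ball x (bd_dist D x) \<inter> frontier D \<noteq> {}"
    using outside by (intro connected_Int_frontier connected_ball)
  then obtain p where p: "p \<in> frontier D" "dist x p < bd_dist D x" by auto
  then show False using infdist_le[OF p(1), of x] by (simp add: bd_dist_def)
qed

text \<open>The segment stays in the ball of radius \<open>bd_dist D x\<close>, so it is an
  admissible curve; as it is shorter than that radius, \<open>1 / (d - s)\<close> stays finite along
  it.\<close>

lemma qh_dist_upper:
  assumes D: "open D" "frontier D \<noteq> {}" and x: "x \<in> D" and y: "norm (x - y) < bd_dist D x"
  shows "qh_dist D x y \<le> ennreal (- ln (1 - norm (x - y) / bd_dist D x))"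
proof -
  define d where "d = bd_dist D x"
  have d: "0 < d" using bd_dist_pos[OF D x] by (simp add: d_def)
  define l where "l = norm (x - y)"
  have l: "0 \<le> l" "l < d" using y by (auto simp: l_def d_def)
  define g where "g = linepath x y"
  have len: "curve_length g 0 t = ennreal (t * l)" if "0 \<le> t" for t
    using curve_length_linepath[OF that, of x y] by (simp add: g_def l_def norm_minus_commute)
  have arclen: "arclen g t = t * l" if "0 \<le> t" for t
    using len[OF that] that l by (simp add: arclen_def)
  have rect: "rectifiable g" by (simp add: rectifiable_def len)
  have dist_g: "norm (g t - x) = t * l" if "0 \<le> t" for t
  proof -
    have "g t - x = t *\<^sub>R (y - x)" by (simp add: g_def linepath_def algebra_simps)
    then show ?thesis using that by (simp add: l_def norm_minus_commute)
  qed
  have "path_image g \<subseteq> D"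
  proof -
    have "g t \<in> ball x d" if "t \<in> {0..1}" for t
    proof -
      have "t * l \<le> 1 * l" using that l by (intro mult_right_mono) auto
      then show ?thesis using dist_g[of t] that l by (simp add: dist_norm norm_minus_commute)
    qed
    then show ?thesis using ball_bd_dist_subset[OF x] by (auto simp: path_image_def d_def)
  qed
  moreover have "arc g \<or> (\<forall>t\<in>{0..1}. g t = x)"
    by (cases "x = y") (auto simp: g_def linepath_refl)
  ultimately have "g \<in> rect_arcs D x y"
    using rect by (simp add: rect_arcs_def) (simp add: g_def)
  then have "qh_dist D x y \<le> line_integral g (\<lambda>z. 1 / bd_dist D z)"
    unfolding qh_dist_def by (rule INF_lower)
  also have "\<dots> \<le> (\<integral>\<^sup>+ s \<in> {0..l}. ennreal (1 / (d - s)) \<partial>lborel)"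
    unfolding line_integral_def
  proof (rule nn_integral_mono)
    fix s
    show "ennreal (1 / bd_dist D (arclen_param g s)) * indicator {0..arclen g 1} s
        \<le> ennreal (1 / (d - s)) * indicator {0..l} s"
    proof (cases "s \<in> {0..l}")
      case True
      then obtain t where t: "t \<in> {0..1}" "arclen g t = s" "arclen_param g s = g t"
        using arclen_param_witness[OF _ rect, of s] arclen[of 1]
        by (auto simp: g_def continuous_on_linepath)
      have "d \<le> bd_dist D (g t) + s"
        using bd_dist_le[of D x "g t"] dist_g[of t] arclen[of t] t
        by (simp add: d_def norm_minus_commute)
      then show ?thesis
        using True t(3) l by (auto intro!: ennreal_leI frac_le simp: indicator_def)
    qed (simp add: arclen)
  qed
  also have "\<dots> = ennreal (- ln (d - l) - - ln (d - 0))"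
    using d l by (intro nn_integral_FTC_Icc) (auto intro!: derivative_eq_intros)
  also have "- ln (d - l) - - ln (d - 0) = - ln (1 - l / d)"
  proof -
    have "1 - l / d = (d - l) / d" using d by (simp add: field_simps)
    then show ?thesis using d l by (simp add: ln_div)
  qed
  finally show ?thesis by (simp add: l_def d_def)
qed

section \<open>Bounds for \<open>c_tilde\<close>\<close>

lemma bd_dist_le_norm: "p \<in> frontier D \<Longrightarrow> bd_dist D x \<le> norm (x - p)"
  unfolding bd_dist_def dist_norm[symmetric] by (rule infdist_le)

text \<open>The maximum is at least \<open>norm (x - p)\<close>. The bound is uniform in
  \<open>p\<close>, so it yields both the upper estimate of the supremum and the boundedness that
  the lower one requires.\<close>

lemma c_tilde_quotient_le:
  assumes "open D" "frontier D \<noteq> {}" "x \<in> D" "p \<in> frontier D"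
  shows "norm (x - y) / max (norm (x - p)) (norm (y - p)) \<le> norm (x - y) / bd_dist D x"
  using bd_dist_pos[OF assms(1-3)] bd_dist_le_norm[OF assms(4), of x]
  by (intro frac_le) auto

lemma c_tilde_upper:
  assumes "open D" "frontier D \<noteq> {}" "x \<in> D"
  shows "c_tilde D x y \<le> norm (x - y) / bd_dist D x"
  unfolding c_tilde_def using assms by (intro cSUP_least c_tilde_quotient_le)

text \<open>For a frontier point \<open>p\<close> nearest to \<open>x\<close>, the triangle
  inequality bounds \<open>norm (y - p)\<close> by
  \<open>bd_dist D x + norm (x - y)\<close>.\<close>

lemma c_tilde_lower:
  assumes D: "open D" "frontier D \<noteq> {}" and x: "x \<in> D"
  shows "norm (x - y) / (bd_dist D x + norm (x - y)) \<le> c_tilde D x y"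
proof -
  obtain p where p: "p \<in> frontier D" "bd_dist D x = norm (x - p)"
    using infdist_attains_inf[OF frontier_closed D(2), of x] by (auto simp: bd_dist_def dist_norm)
  have "norm (x - y) / (bd_dist D x + norm (x - y))
      \<le> norm (x - y) / max (norm (x - p)) (norm (y - p))"
  proof (rule divide_left_mono)
    have "norm (y - p) \<le> norm (x - p) + norm (x - y)" by norm
    then show "max (norm (x - p)) (norm (y - p)) \<le> bd_dist D x + norm (x - y)"
      using p by simp
    have "0 < norm (x - p)" using bd_dist_pos[OF D x] p by simp
    then show "0 < (bd_dist D x + norm (x - y)) * max (norm (x - p)) (norm (y - p))"
      using p by (intro mult_pos_pos) (auto simp: add_pos_nonneg less_max_iff_disj)
  qed simp
  also have "\<dots> \<le> c_tilde D x y"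
    unfolding c_tilde_def
    using c_tilde_quotient_le[OF D x] p(1) by (intro cSUP_upper bdd_aboveI2) auto
  finally show ?thesis .
qed

section \<open>Inclusions of the balls and the ratio of the radii\<close>

theorem theorem6:
  fixes D :: "(real ^ 'n) set"
  assumes "open D" and "D \<subset> UNIV" and "frontier D \<noteq> {}"
  shows "(\<forall>x\<in>D. \<forall>r::real. 0 < r \<and> r < 1 / 2 \<longrightarrow>
            qh_ball D x (ln (1 + r)) \<subseteq> c_tilde_ball D x r \<and>
            c_tilde_ball D x r \<subseteq> qh_ball D x (ln (1 + r / (1 - 2 * r))))
       \<and> ((\<lambda>r::real. ln (1 + r / (1 - 2 * r)) / ln (1 + r)) \<longlongrightarrow> 1) (at_right 0)"
proof (intro conjI ballI allI impI; (elim conjE)?)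
  fix x and r :: real assume x: "x \<in> D" and r: "0 < r" "r < 1 / 2"
  define d where "d = bd_dist D x"
  have d: "0 < d" using bd_dist_pos[OF assms(1,3) x] by (simp add: d_def)
  show "qh_ball D x (ln (1 + r)) \<subseteq> c_tilde_ball D x r"
  proof
    fix y assume y: "y \<in> qh_ball D x (ln (1 + r))"
    then have "ennreal (ln (1 + norm (x - y) / d)) < ennreal (ln (1 + r))"
      using qh_dist_lower[OF assms(1,3) x, of y] unfolding qh_ball_def d_def
      by (auto intro: le_less_trans)
    moreover have nonneg: "0 \<le> norm (x - y) / d" using d by simp
    ultimately have "ln (1 + norm (x - y) / d) < ln (1 + r)"
      by (subst (asm) ennreal_less_iff) auto
    then have "norm (x - y) / d < r"
      using nonneg r by (subst (asm) ln_less_cancel_iff) auto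
    then show "y \<in> c_tilde_ball D x r"
      using c_tilde_upper[OF assms(1,3) x, of y] y
      by (simp add: c_tilde_ball_def qh_ball_def d_def)
  qed
  show "c_tilde_ball D x r \<subseteq> qh_ball D x (ln (1 + r / (1 - 2 * r)))"
  proof
    fix y assume y: "y \<in> c_tilde_ball D x r"
    define l where "l = norm (x - y)"
    have l: "0 \<le> l" by (simp add: l_def)
    have "l / (d + l) < r"
      using c_tilde_lower[OF assms(1,3) x, of y] y
      by (simp add: c_tilde_ball_def l_def d_def)
    then have less: "l * (1 - r) < r * d"
      using d l by (simp add: field_simps)
    then have ratio: "l / d < r / (1 - r)"
      using d r by (simp add: field_simps)
    \<comment> \<open>This is where \<open>r < 1 / 2\<close> enters: it makes the segment shorter
      than \<open>d\<close>, as \<open>qh_dist_upper\<close> requires.\<close>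
    moreover have "r / (1 - r) < 1" using r by simp
    ultimately have "l / d < 1" by linarith
    then have "l < d" using d by simp
    then have "qh_dist D x y \<le> ennreal (- ln (1 - l / d))"
      using qh_dist_upper[OF assms(1,3) x, of y] by (simp add: l_def d_def)
    also have "\<dots> < ennreal (ln (1 + r / (1 - 2 * r)))"
    proof (rule ennreal_lessI)
      show "0 < ln (1 + r / (1 - 2 * r))"
        using r by (intro ln_gt_zero) simp
      \<comment> \<open>Both sides equal \<open>(1 - r) / (1 - 2 * r)\<close>, so the outer radius
        is the segment bound \<open>- ln (1 - l / d)\<close> with \<open>r / (1 - r)\<close> in
        place of \<open>l / d\<close>.\<close>
      have inv: "1 + r / (1 - 2 * r) = inverse (1 - r / (1 - r))"
        using r by (simp add: field_simps)
      have "ln (1 - r / (1 - r)) < ln (1 - l / d)"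
        using ratio \<open>r / (1 - r) < 1\<close> \<open>l / d < 1\<close> by (subst ln_less_cancel_iff) auto
      then show "- ln (1 - l / d) < ln (1 + r / (1 - 2 * r))"
        unfolding inv using r by (subst ln_inverse) auto
    qed
    finally show "y \<in> qh_ball D x (ln (1 + r / (1 - 2 * r)))"
      using y by (simp add: qh_ball_def c_tilde_ball_def)
  qed
next
  show "((\<lambda>r::real. ln (1 + r / (1 - 2 * r)) / ln (1 + r)) \<longlongrightarrow> 1) (at_right 0)"
    \<comment> \<open>Both logarithms are asymptotic to \<open>r\<close> as \<open>r\<close> tends
      to 0 from the right.\<close>
    by real_asymp
qed

end
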